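(* Consider the ExtSTS method built from $s$-stage additive Runge--Kutta tables $A^I,A^E$ with shared abscissae $c$ (as given in the context), applied with step size $h>0$ to the scalar test problem $$y'(t)=\lambda^Ay+\lambda^Dy+\lambda^Ry,\qquad y(0)=1,$$ with partitioning $\mathbf{f}^A(t,y)=\lambda^Ay$, $\mathbf{f}^D(t,y)=\lambda^Dy$, $\mathbf{f}^R(t,y)=\lambda^Ry$, where $\lambda^D\in\mathbb{R}$, $\lambda^D<0$, and $\lambda^A,\lambda^R\in\mathbb{C}$ have negative real part. Let $\eta^D=h\lambda^D$, $\eta^A=h\lambda^A$, $\eta^R=h\lambda^R$. Then the method has stability function $$\mathcal{R}(\eta^D,\eta^A,\eta^R)=\mathbf{e}_s^T\left[I-P-Q\left(\eta^RA^I+\eta^AA^E\right)\right]^{-1}\mathbf{e}_1,$$ that is, $y_{n+1}=\mathcal{R}(\eta^D,\eta^A,\eta^R)\,y_n$. Here $\mathbf{e}_1,\mathbf{e}_s$ are the first and last columns of the $s\times s$ identity matrix $I$, and $P,Q$ are the $s\times s$ matrices $$P=\operatorname{diag}\left(\begin{bmatrix}\mathcal{R}^D_{RK}(\Delta c_2\eta^D)\\ \vdots\\ \mathcal{R}^D_{RK}(\Delta c_s\eta^D)\end{bmatrix},-1\right),$$ $$Q=\operatorname{diag}\left(\begin{bmatrix}0\\ \mathcal{R}^D_F(\Delta c_2\eta^D)\\ \vdots\\ \mathcal{R}^D_F(\Delta c_s\eta^D)\end{bmatrix},0\right)-\operatorname{diag}\left(\begin{bmatrix}\mathcal{R}^D_F(\Delta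 c_2\eta^D)\\ \vdots\\ \mathcal{R}^D_F(\Delta c_s\eta^D)\end{bmatrix},-1\right),$$ where $\operatorname{diag}(w,k)$ is the matrix with the vector $w$ on its $k$-th diagonal ($k=0$ the main diagonal, $k=-1$ the first subdiagonal) and zeros elsewhere.
   Context: **Tables.** $A^I\in\mathbb{R}^{s\times s}$ is lower triangular, $A^E\in\mathbb{R}^{s\times s}$ is strictly lower triangular (entries $a^I_{i,j},a^E_{i,j}$); the shared abscissae $c\in\mathbb{R}^s$ satisfy $c_1=0$, $c_s=1$, $\Delta c_i:=c_i-c_{i-1}\ge0$ for $i=2,\dots,s$. Both tables satisfy the usual row-sum condition $A^I\mathbf 1=A^E\mathbf 1=c$, are stiffly accurate (the last rows of $A^I,A^E$ equal the weights $b^I,b^E$), and are solve-decoupled: $a^I_{i,i}\Delta c_i=0$ for $i=2,\dots,s$. **ExtSTS method.** One step from $y_n$ at $t_n$ to $y_{n+1}$ at $t_n+h$ for $y'=\mathbf{f}^A+\mathbf{f}^D+\mathbf{f}^R$: let $T_i=t_n+c_ih$, $z_1=y_n$, $\mathbf{f}^\sigma_j=\mathbf{f}^\sigma(T_j,z_j)$. For $i=2,\dots,s$ let $$g_i=h\sum_{j=1}^{i-1}\left[(a^I_{i,j}-a^I_{i-1,j})\mathbf{f}^R_j+(a^E_{i,j}-a^E_{i-1,j})\mathbf{f}^A_j\right].$$ If $a^I_{i,i}=0$ and $\Delta c_i>0$, then $z_i$ is the result of one step of a super-time-stepping (STS) method over $[T_{i-1},T_i]$ (step size $h_i=\Delta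 c_ih$) applied to $v_i'(t)=\mathbf{f}^D(t,v_i)+\frac{g_i}{\Delta c_ih}$, $v_i(T_{i-1})=z_{i-1}$. Otherwise $z_i$ is obtained by solving $z_i-ha^I_{i,i}\mathbf{f}^R_i=z_{i-1}+g_i$. Finally $y_{n+1}=z_s$. **STS method and its propagation functions.** The STS method used at stage $i$ is an explicit Runge--Kutta method with Butcher table $\{A^D,b^D,c^D\}$, $A^D$ strictly lower triangular, $A^D\mathbf{1}=c^D$, $b^D\cdot\mathbf{1}=1$; its number of stages $s_i^D$ (hence the table) may depend on $i$ through $\Delta c_i\eta^D$, being chosen as the minimal integer for which the method is stable. For this table define $$\mathcal{R}^D_{RK}(x)=1+x\,b^D\cdot(I-xA^D)^{-1}\mathbf{1},\qquad \mathcal{R}^D_F(x)=1+x\,b^D\cdot(I-xA^D)^{-1}c^D,$$ evaluated at $x=\Delta c_i\eta^D$ with the stage-$i$ table; in particular $\mathcal{R}^D_{RK}(0)=\mathcal{R}^D_F(0)=1$. The parameters are understood to be such that the implicit stage equations are uniquely solvable, i.e. $1-\eta^Ra^I_{i,i}\neq0$ for $i=2,\dots,s$. *)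

theory Defs
  imports Complex_Main "Jordan_Normal_Form.Gauss_Jordan_Elimination"
begin

text \<open>
  Vectors and matrices are those of the Jordan normal form library, so indices start at 0:
  the stage with number \<open>i\<close> here (\<open>i = 0, ..., s - 1\<close>) is stage \<open>i + 1\<close> in the usual
  one-based numbering.
\<close>

abbreviation ones_vec :: "nat \<Rightarrow> 'a::one vec" where
  "ones_vec n \<equiv> vec n (\<lambda>_. 1)"

text \<open>The value is meaningful only for invertible matrices.\<close>

abbreviation mat_inv :: "'a::field mat \<Rightarrow> 'a mat" where
  "mat_inv M \<equiv> the (mat_inverse M)"

definition diag_vec :: "'a::zero vec \<Rightarrow> int \<Rightarrow> 'a mat" where
  "diag_vec w k =
    (let n = dim_vec w + nat \<bar>k\<bar>
     in mat n n (\<lambda>(i, j). if int j - int i = k then w $ min i j else 0))"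


subsection \<open>Explicit Runge--Kutta methods\<close>

record rk_table =
  rk_A :: "real mat"
  rk_b :: "real vec"
  rk_c :: "real vec"

definition explicit_rk :: "nat \<Rightarrow> rk_table \<Rightarrow> bool" where
  "explicit_rk m T \<longleftrightarrow>
     rk_A T \<in> carrier_mat m m \<and> rk_b T \<in> carrier_vec m \<and> rk_c T \<in> carrier_vec m \<and>
     (\<forall>k<m. \<forall>l<m. k \<le> l \<longrightarrow> rk_A T $$ (k, l) = 0) \<and>
     rk_A T *\<^sub>v ones_vec m = rk_c T \<and>
     rk_b T \<bullet> ones_vec m = 1"

fun rk_stage ::
  "rk_table \<Rightarrow> (real \<Rightarrow> 'a \<Rightarrow> 'a) \<Rightarrow> real \<Rightarrow> real \<Rightarrow> 'a \<Rightarrow> nat \<Rightarrow> 'a::real_vector" where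
  "rk_stage T f t h v k =
     v + h *\<^sub>R (\<Sum>l<k. rk_A T $$ (k, l) *\<^sub>R f (t + rk_c T $ l * h) (rk_stage T f t h v l))"

declare rk_stage.simps [simp del]

definition rk_step ::
  "rk_table \<Rightarrow> (real \<Rightarrow> 'a \<Rightarrow> 'a) \<Rightarrow> real \<Rightarrow> real \<Rightarrow> 'a \<Rightarrow> 'a::real_vector" where
  "rk_step T f t h v =
     v + h *\<^sub>R (\<Sum>l<dim_vec (rk_b T).
       rk_b T $ l *\<^sub>R f (t + rk_c T $ l * h) (rk_stage T f t h v l))"

definition prop_RK :: "rk_table \<Rightarrow> real \<Rightarrow> real" where
  "prop_RK T x =
     (let m = dim_vec (rk_b T)
      in 1 + x * (rk_b T \<bullet> (mat_inv (1\<^sub>m m - x \<cdot>\<^sub>m rk_A T) *\<^sub>v ones_vec m)))"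

definition prop_F :: "rk_table \<Rightarrow> real \<Rightarrow> real" where
  "prop_F T x =
     (let m = dim_vec (rk_b T)
      in 1 + x * (rk_b T \<bullet> (mat_inv (1\<^sub>m m - x \<cdot>\<^sub>m rk_A T) *\<^sub>v rk_c T)))"

text \<open>
  A super-time-stepping method is a family \<open>sts\<close> of explicit tables, one for each admissible
  number of stages \<open>m \<in> M\<close>. The method used at the argument \<open>x\<close> is the member with the fewest
  stages that is stable at \<open>x\<close>; the notion of stability is the parameter \<open>stab m x\<close>.
\<close>

definition sts_table ::
  "nat set \<Rightarrow> (nat \<Rightarrow> real \<Rightarrow> bool) \<Rightarrow> (nat \<Rightarrow> rk_table) \<Rightarrow> real \<Rightarrow> rk_table" where
  "sts_table M stab sts x = sts (LEAST m. m \<in> M \<and> stab m x)"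


subsection \<open>The ExtSTS method\<close>

definition dc :: "real vec \<Rightarrow> nat \<Rightarrow> real" where
  "dc c i = c $ i - c $ (i - 1)"

definition ext_sts_tables ::
  "nat \<Rightarrow> real mat \<Rightarrow> real vec \<Rightarrow> real mat \<Rightarrow> real vec \<Rightarrow> real vec \<Rightarrow> bool" where
  "ext_sts_tables s AI bI AE bE c \<longleftrightarrow>
     1 \<le> s \<and>
     AI \<in> carrier_mat s s \<and> AE \<in> carrier_mat s s \<and>
     bI \<in> carrier_vec s \<and> bE \<in> carrier_vec s \<and> c \<in> carrier_vec s \<and>
     (\<forall>i<s. \<forall>j<s. i < j \<longrightarrow> AI $$ (i, j) = 0) \<and>
     (\<forall>i<s. \<forall>j<s. i \<le> j \<longrightarrow> AE $$ (i, j) = 0) \<and>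
     c $ 0 = 0 \<and> c $ (s - 1) = 1 \<and> (\<forall>i\<in>{1..<s}. 0 \<le> dc c i) \<and>
     AI *\<^sub>v ones_vec s = c \<and> AE *\<^sub>v ones_vec s = c \<and>
     row AI (s - 1) = bI \<and> row AE (s - 1) = bE \<and>
     (\<forall>i\<in>{1..<s}. AI $$ (i, i) * dc c i = 0)"

definition ext_sts_g ::
  "real mat \<Rightarrow> real mat \<Rightarrow> real vec \<Rightarrow> (real \<Rightarrow> 'a \<Rightarrow> 'a) \<Rightarrow> (real \<Rightarrow> 'a \<Rightarrow> 'a) \<Rightarrow>
   real \<Rightarrow> real \<Rightarrow> (nat \<Rightarrow> 'a) \<Rightarrow> nat \<Rightarrow> 'a::real_vector" where
  "ext_sts_g AI AE c fA fR h t z i =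
     h *\<^sub>R (\<Sum>j<i.
       (AI $$ (i, j) - AI $$ (i - 1, j)) *\<^sub>R fR (t + c $ j * h) (z j) +
       (AE $$ (i, j) - AE $$ (i - 1, j)) *\<^sub>R fA (t + c $ j * h) (z j))"

text \<open>
  \<open>ext_sts_step AI AE c T fA fD fR h t y y'\<close>: one step of size \<open>h\<close> from \<open>y\<close> at time \<open>t\<close> may
  produce \<open>y'\<close>, where \<open>T i\<close> is the super-time-stepping table used at stage \<open>i\<close>. It is a
  relation because the implicit stage equations need not be uniquely solvable in general.
\<close>

definition ext_sts_step ::
  "real mat \<Rightarrow> real mat \<Rightarrow> real vec \<Rightarrow> (nat \<Rightarrow> rk_table) \<Rightarrow>
   (real \<Rightarrow> 'a \<Rightarrow> 'a) \<Rightarrow> (real \<Rightarrow> 'a \<Rightarrow> 'a) \<Rightarrow> (real \<Rightarrow> 'a \<Rightarrow> 'a) \<Rightarrow>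
   real \<Rightarrow> real \<Rightarrow> 'a \<Rightarrow> 'a::real_vector \<Rightarrow> bool" where
  "ext_sts_step AI AE c T fA fD fR h t y y' \<longleftrightarrow>
     (\<exists>z. z 0 = y \<and>
        (\<forall>i\<in>{1..<dim_vec c}.
           let g = ext_sts_g AI AE c fA fR h t z i in
           if AI $$ (i, i) = 0 \<and> 0 < dc c i
           then z i = rk_step (T i) (\<lambda>\<tau> v. fD \<tau> v + (1 / (dc c i * h)) *\<^sub>R g)
                        (t + c $ (i - 1) * h) (dc c i * h) (z (i - 1))
           else z i - (h * AI $$ (i, i)) *\<^sub>R fR (t + c $ i * h) (z i) = z (i - 1) + g) \<and>
        y' = z (dim_vec c - 1))"


subsection \<open>The stability function\<close>

text \<open>Here \<open>tab x\<close> is the super-time-stepping table used at the argument \<open>x\<close>.\<close>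

definition sts_P :: "(real \<Rightarrow> rk_table) \<Rightarrow> real vec \<Rightarrow> real \<Rightarrow> complex mat" where
  "sts_P tab c etaD =
     (let w = vec (dim_vec c - 1)
        (\<lambda>k. let x = dc c (k + 1) * etaD in complex_of_real (prop_RK (tab x) x))
      in diag_vec w (-1))"

definition sts_Q :: "(real \<Rightarrow> rk_table) \<Rightarrow> real vec \<Rightarrow> real \<Rightarrow> complex mat" where
  "sts_Q tab c etaD =
     (let w = vec (dim_vec c - 1)
        (\<lambda>k. let x = dc c (k + 1) * etaD in complex_of_real (prop_F (tab x) x))
      in diag_vec (vCons 0 w) 0 - diag_vec w (-1))"

definition ext_sts_matrix ::
  "(real \<Rightarrow> rk_table) \<Rightarrow> real mat \<Rightarrow> real mat \<Rightarrow> real vec \<Rightarrow>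
   real \<Rightarrow> complex \<Rightarrow> complex \<Rightarrow> complex mat" where
  "ext_sts_matrix tab AI AE c etaD etaA etaR =
     1\<^sub>m (dim_vec c) - sts_P tab c etaD -
     sts_Q tab c etaD * (etaR \<cdot>\<^sub>m map_mat complex_of_real AI + etaA \<cdot>\<^sub>m map_mat complex_of_real AE)"

definition ext_sts_stability ::
  "(real \<Rightarrow> rk_table) \<Rightarrow> real mat \<Rightarrow> real mat \<Rightarrow> real vec \<Rightarrow>
   real \<Rightarrow> complex \<Rightarrow> complex \<Rightarrow> complex" where
  "ext_sts_stability tab AI AE c etaD etaA etaR =
     unit_vec (dim_vec c) (dim_vec c - 1) \<bullet>
       (mat_inv (ext_sts_matrix tab AI AE c etaD etaA etaR) *\<^sub>v unit_vec (dim_vec c) 0)"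

end

theory Submission
  imports Defs "Jordan_Normal_Form.Determinant"
begin

text \<open>
  On a linear problem every stage of the method is a linear equation between the stage values,
  and these equations are exactly the rows of
  \<open>(I - P - Q (\<eta>\<^sup>R A\<^sup>I + \<eta>\<^sup>A A\<^sup>E)) z = y\<^sub>n e\<^sub>1\<close>.

  The analytic content is one computation (\<open>rk_step_affine\<close>): an explicit Runge--Kutta method
  applied to \<open>v' = \<lambda> v + g\<close> gives \<open>\<R>\<^sub>R\<^sub>K(x) v + \<R>\<^sub>F(x) h g\<close> with \<open>x = h \<lambda>\<close>, because the stage values solve
  \<open>(I - x A) V = v \<one> + h g c\<close>. For a super-time-stepping stage this gives
  \<open>z\<^sub>i = \<R>\<^sub>R\<^sub>K z\<^sub>i\<^sub>-\<^sub>1 + \<R>\<^sub>F g\<^sub>i\<close>. A stage which is not of that kind has \<open>\<Delta>c\<^sub>i = 0\<close>, by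
  solve-decoupling and the monotonicity of the abscissae. Both propagation functions equal 1
  there, and the stage equation is
  \<open>z\<^sub>i = \<R>\<^sub>R\<^sub>K z\<^sub>i\<^sub>-\<^sub>1 + \<R>\<^sub>F (g\<^sub>i + \<eta>\<^sup>R a\<^sup>I\<^sub>i\<^sub>i z\<^sub>i)\<close>. The latter form covers the first kind as well,
  since \<open>a\<^sup>I\<^sub>i\<^sub>i = 0\<close> there (\<open>ext_sts_stage_iff\<close>). On the other side, row \<open>i \<ge> 2\<close> of \<open>Q\<close>
  has \<open>\<R>\<^sub>F\<close> on the diagonal and \<open>-\<R>\<^sub>F\<close> before it, so that multiplication by \<open>Q\<close> takes the differences of
  consecutive rows of \<open>\<eta>\<^sup>R A\<^sup>I + \<eta>\<^sup>A A\<^sup>E\<close> that occur in \<open>g\<^sub>i\<close> (\<open>ext_sts_matrix_mult_nth\<close>).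

  The matrix is lower triangular. Its first diagonal entry is 1 and the others are
  \<open>1 - \<R>\<^sub>F \<eta>\<^sup>R a\<^sup>I\<^sub>i\<^sub>i\<close>. These equal \<open>1 - \<eta>\<^sup>R a\<^sup>I\<^sub>i\<^sub>i\<close>, as \<open>\<R>\<^sub>F = 1\<close> wherever \<open>a\<^sup>I\<^sub>i\<^sub>i \<noteq> 0\<close>, and so
  do not vanish. Hence the linear system has exactly one solution, and its last component is the result of the step.
\<close>

section \<open>Matrices\<close>

lemma mult_mat_vec_nth_sum:
  fixes A :: "'a::comm_semiring_0 mat"
  assumes "A \<in> carrier_mat n m" "v \<in> carrier_vec m" "i < n"
  shows "(A *\<^sub>v v) $ i = (\<Sum>j<m. A $$ (i, j) * v $ j)"
  using assms by (auto simp: scalar_prod_def lessThan_atLeast0 intro!: sum.cong)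

lemma mat_inv_of_det_nonzero:
  fixes A :: "'a::field mat"
  assumes A: "A \<in> carrier_mat n n" and "det A \<noteq> 0"
  shows "mat_inv A \<in> carrier_mat n n" "A * mat_inv A = 1\<^sub>m n" "mat_inv A * A = 1\<^sub>m n"
proof -
  have "A \<in> Units (ring_mat TYPE('a) n ())"
    by (rule det_non_zero_imp_unit[OF assms])
  then obtain B where "mat_inverse A = Some B"
    using mat_inverse(1)[OF A, where b = "()"] by (cases "mat_inverse A") auto
  with mat_inverse(2)[OF A this]
  show "mat_inv A \<in> carrier_mat n n" "A * mat_inv A = 1\<^sub>m n" "mat_inv A * A = 1\<^sub>m n"
    by auto
qed

lemma mult_mat_vec_eq_iff_mat_inv:
  fixes A :: "'a::field mat"
  assumes A: "A \<in> carrier_mat n n" and "det A \<noteq> 0"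
    and u: "u \<in> carrier_vec n" and w: "w \<in> carrier_vec n"
  shows "A *\<^sub>v u = w \<longleftrightarrow> u = mat_inv A *\<^sub>v w"
proof -
  note inv = mat_inv_of_det_nonzero[of A n, OF assms(1,2)]
  show ?thesis
  proof
    assume "A *\<^sub>v u = w"
    hence "mat_inv A *\<^sub>v w = (mat_inv A * A) *\<^sub>v u"
      using assoc_mult_mat_vec[OF inv(1) A u] by simp
    thus "u = mat_inv A *\<^sub>v w"
      using inv(3) u by simp
  next
    assume "u = mat_inv A *\<^sub>v w"
    hence "A *\<^sub>v u = (A * mat_inv A) *\<^sub>v w"
      using assoc_mult_mat_vec[OF A inv(1) w] by simp
    thus "A *\<^sub>v u = w"
      using inv(2) w by simp
  qed
qed

lemma det_lower_triangular_nonzero: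
  fixes A :: "'a::idom mat"
  assumes "A \<in> carrier_mat n n"
    and "\<And>i j. i < j \<Longrightarrow> j < n \<Longrightarrow> A $$ (i, j) = 0"
    and "\<And>i. i < n \<Longrightarrow> A $$ (i, i) \<noteq> 0"
  shows "det A \<noteq> 0"
  using assms by (simp add: det_lower_triangular[of n] prod_list_diag_prod)

lemma diag_vec_carrier: "diag_vec w k \<in> carrier_mat (dim_vec w + nat \<bar>k\<bar>) (dim_vec w + nat \<bar>k\<bar>)"
  by (simp add: diag_vec_def Let_def)

lemma diag_vec_0_mult_nth:
  fixes w :: "'a::comm_semiring_0 vec"
  assumes "v \<in> carrier_vec (dim_vec w)" "i < dim_vec w"
  shows "(diag_vec w 0 *\<^sub>v v) $ i = w $ i * v $ i"
proof -
  have "(diag_vec w 0 *\<^sub>v v) $ i = (\<Sum>j<dim_vec w. diag_vec w 0 $$ (i, j) * v $ j)"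
    using assms diag_vec_carrier[of w 0] by (intro mult_mat_vec_nth_sum) auto
  also have "\<dots> = (\<Sum>j<dim_vec w. if j = i then w $ i * v $ i else 0)"
    using assms by (intro sum.cong) (auto simp: diag_vec_def Let_def)
  finally show ?thesis
    using assms by simp
qed

lemma diag_vec_subdiag_mult_nth:
  fixes w :: "'a::comm_semiring_0 vec"
  assumes "v \<in> carrier_vec (dim_vec w + 1)" "i < dim_vec w + 1"
  shows "(diag_vec w (-1) *\<^sub>v v) $ i = (if i = 0 then 0 else w $ (i - 1) * v $ (i - 1))"
proof -
  have "(diag_vec w (-1) *\<^sub>v v) $ i = (\<Sum>j<dim_vec w + 1. diag_vec w (-1) $$ (i, j) * v $ j)"
    using assms diag_vec_carrier[of w "-1"] by (intro mult_mat_vec_nth_sum) auto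
  also have "\<dots> = (\<Sum>j<dim_vec w + 1.
      if j = i - 1 then (if i = 0 then 0 else w $ (i - 1) * v $ (i - 1)) else 0)"
    using assms by (intro sum.cong) (auto simp: diag_vec_def Let_def min_def)
  finally show ?thesis
    using assms by (auto simp del: sum.lessThan_Suc)
qed


section \<open>Explicit Runge--Kutta methods on an affine problem\<close>

text \<open>
  Since \<open>A\<close> is strictly lower triangular, \<open>I - x A\<close> is unit lower triangular, and forward
  substitution determines the components of \<open>(I - x A)\<^sup>-\<^sup>1 w\<close> one after the other. This is the
  same recursion as the one that defines the stages of the method.
\<close>

lemma explicit_rk_resolvent_nth:
  assumes T: "explicit_rk m T" and w: "w \<in> carrier_vec m" and k: "k < m"
  shows "(mat_inv (1\<^sub>m m - x \<cdot>\<^sub>m rk_A T) *\<^sub>v w) $ k =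
    w $ k + x * (\<Sum>l<k. rk_A T $$ (k, l) * (mat_inv (1\<^sub>m m - x \<cdot>\<^sub>m rk_A T) *\<^sub>v w) $ l)"
proof -
  define R where "R = 1\<^sub>m m - x \<cdot>\<^sub>m rk_A T"
  define u where "u = mat_inv R *\<^sub>v w"
  have A: "rk_A T \<in> carrier_mat m m"
    and low: "\<And>k l. k < m \<Longrightarrow> l < m \<Longrightarrow> k \<le> l \<Longrightarrow> rk_A T $$ (k, l) = 0"
    using T by (auto simp: explicit_rk_def)
  have R: "R \<in> carrier_mat m m"
    unfolding R_def by (intro minus_carrier_mat smult_carrier_mat A)
  have det: "det R \<noteq> 0"
    using A low by (intro det_lower_triangular_nonzero[OF R]) (auto simp: R_def)
  have u: "u \<in> carrier_vec m"
    unfolding u_def using mat_inv_of_det_nonzero(1)[OF R det] w by (rule mult_mat_vec_carrier)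
  have "R *\<^sub>v u = w"
    using mult_mat_vec_eq_iff_mat_inv[OF R det u w] by (simp add: u_def)
  hence "w $ k = (\<Sum>l<m. R $$ (k, l) * u $ l)"
    using mult_mat_vec_nth_sum[OF R u k] by simp
  also have "\<dots> = (\<Sum>l<m. (if l = k then u $ k else 0) - x * (rk_A T $$ (k, l) * u $ l))"
    using A k by (intro sum.cong) (auto simp: R_def algebra_simps)
  also have "\<dots> = u $ k - x * (\<Sum>l<m. rk_A T $$ (k, l) * u $ l)"
    using k by (simp add: sum_subtractf sum_distrib_left)
  also have "(\<Sum>l<m. rk_A T $$ (k, l) * u $ l) = (\<Sum>l<k. rk_A T $$ (k, l) * u $ l)"
    using k low by (intro sum.mono_neutral_right) auto
  finally show ?thesis
    by (simp add: u_def R_def)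
qed

lemma explicit_rk_c_nth:
  assumes T: "explicit_rk m T" and k: "k < m"
  shows "rk_c T $ k = (\<Sum>l<k. rk_A T $$ (k, l))"
proof -
  have A: "rk_A T \<in> carrier_mat m m"
    and low: "\<And>k l. k < m \<Longrightarrow> l < m \<Longrightarrow> k \<le> l \<Longrightarrow> rk_A T $$ (k, l) = 0"
    and c: "rk_A T *\<^sub>v ones_vec m = rk_c T"
    using T by (auto simp: explicit_rk_def)
  have "rk_c T $ k = (\<Sum>l<m. rk_A T $$ (k, l) * ones_vec m $ l)"
    unfolding c[symmetric] using A k by (intro mult_mat_vec_nth_sum) auto
  also have "\<dots> = (\<Sum>l<m. rk_A T $$ (k, l))"
    by simp
  also have "\<dots> = (\<Sum>l<k. rk_A T $$ (k, l))"
    using k low by (intro sum.mono_neutral_right) auto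
  finally show ?thesis .
qed

text \<open>
  The stage equations read \<open>V = v \<one> + h A (\<lambda> V + g \<one>)\<close>. With \<open>A \<one> = c\<close> they become
  \<open>(I - h \<lambda> A) V = v \<one> + h g c\<close>.
\<close>

lemma rk_stage_affine:
  fixes v g :: "'a::real_vector"
  assumes T: "explicit_rk m T" and k: "k < m"
  shows "rk_stage T (\<lambda>\<tau> y. lam *\<^sub>R y + g) t h v k =
    (mat_inv (1\<^sub>m m - (h * lam) \<cdot>\<^sub>m rk_A T) *\<^sub>v ones_vec m) $ k *\<^sub>R v +
    (mat_inv (1\<^sub>m m - (h * lam) \<cdot>\<^sub>m rk_A T) *\<^sub>v rk_c T) $ k *\<^sub>R (h *\<^sub>R g)"
  using k
proof (induction k rule: less_induct)
  case (less k)
  define u where "u = mat_inv (1\<^sub>m m - (h * lam) \<cdot>\<^sub>m rk_A T) *\<^sub>v ones_vec m"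
  define w where "w = mat_inv (1\<^sub>m m - (h * lam) \<cdot>\<^sub>m rk_A T) *\<^sub>v rk_c T"
  have c: "rk_c T \<in> carrier_vec m"
    using T by (simp add: explicit_rk_def)
  have u: "u $ k = 1 + h * lam * (\<Sum>l<k. rk_A T $$ (k, l) * u $ l)"
    using explicit_rk_resolvent_nth[OF T _ less.prems, of "ones_vec m"] less.prems
    by (simp add: u_def)
  have w: "w $ k = (\<Sum>l<k. rk_A T $$ (k, l)) + h * lam * (\<Sum>l<k. rk_A T $$ (k, l) * w $ l)"
    using explicit_rk_resolvent_nth[OF T c less.prems] explicit_rk_c_nth[OF T less.prems]
    by (simp add: w_def)
  have "rk_stage T (\<lambda>\<tau> y. lam *\<^sub>R y + g) t h v k =
      v + h *\<^sub>R (\<Sum>l<k. rk_A T $$ (k, l) *\<^sub>R (lam *\<^sub>R (u $ l *\<^sub>R v + w $ l *\<^sub>R (h *\<^sub>R g)) + g))"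
    using less.IH less.prems
    by (subst rk_stage.simps) (auto simp: u_def w_def intro!: sum.cong)
  also have "\<dots> = u $ k *\<^sub>R v + w $ k *\<^sub>R (h *\<^sub>R g)"
    unfolding u w
    by (simp add: scaleR_add_left scaleR_add_right sum.distrib scaleR_sum_left scaleR_sum_right
        sum_distrib_left sum_distrib_right distrib_left mult_ac)
  finally show ?case
    by (simp add: u_def w_def)
qed

text \<open>
  The forcing contributes \<open>h g\<close> with the coefficient \<open>b \<bullet> \<one> + x b \<bullet> (I - x A)\<^sup>-\<^sup>1 c\<close>, whose first
  term is 1 by consistency.
\<close>

lemma rk_step_affine:
  fixes v g :: "'a::real_vector"
  assumes T: "explicit_rk m T"
  shows "rk_step T (\<lambda>\<tau> y. lam *\<^sub>R y + g) t h v =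
    prop_RK T (h * lam) *\<^sub>R v + prop_F T (h * lam) *\<^sub>R (h *\<^sub>R g)"
proof -
  define u where "u = mat_inv (1\<^sub>m m - (h * lam) \<cdot>\<^sub>m rk_A T) *\<^sub>v ones_vec m"
  define w where "w = mat_inv (1\<^sub>m m - (h * lam) \<cdot>\<^sub>m rk_A T) *\<^sub>v rk_c T"
  have b: "dim_vec (rk_b T) = m" and A: "rk_A T \<in> carrier_mat m m"
    using T by (auto simp: explicit_rk_def)
  have "det (1\<^sub>m m - (h * lam) \<cdot>\<^sub>m rk_A T) \<noteq> 0"
    using T by (intro det_lower_triangular_nonzero[of _ m]) (auto simp: explicit_rk_def)
  hence inv: "mat_inv (1\<^sub>m m - (h * lam) \<cdot>\<^sub>m rk_A T) \<in> carrier_mat m m"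
    using A by (intro mat_inv_of_det_nonzero(1)) auto
  have dims: "dim_vec u = m" "dim_vec w = m"
    using inv by (auto simp: u_def w_def)
  have b1: "(\<Sum>l<m. rk_b T $ l) = 1"
    using T by (auto simp: explicit_rk_def scalar_prod_def lessThan_atLeast0)
  have RK: "prop_RK T (h * lam) = 1 + h * lam * (\<Sum>l<m. rk_b T $ l * u $ l)"
    unfolding prop_RK_def Let_def b u_def[symmetric]
    by (simp add: scalar_prod_def lessThan_atLeast0 dims)
  have F: "prop_F T (h * lam) = (\<Sum>l<m. rk_b T $ l) + h * lam * (\<Sum>l<m. rk_b T $ l * w $ l)"
    unfolding b1
    unfolding prop_F_def Let_def b w_def[symmetric]
    by (simp add: scalar_prod_def lessThan_atLeast0 dims)
  have "rk_step T (\<lambda>\<tau> y. lam *\<^sub>R y + g) t h v =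
      v + h *\<^sub>R (\<Sum>l<m. rk_b T $ l *\<^sub>R (lam *\<^sub>R (u $ l *\<^sub>R v + w $ l *\<^sub>R (h *\<^sub>R g)) + g))"
    unfolding rk_step_def b
    by (auto simp: rk_stage_affine[OF T] u_def w_def intro!: sum.cong)
  also have "\<dots> = prop_RK T (h * lam) *\<^sub>R v + prop_F T (h * lam) *\<^sub>R (h *\<^sub>R g)"
    unfolding RK F
    by (simp add: scaleR_add_left scaleR_add_right sum.distrib scaleR_sum_left scaleR_sum_right
        sum_distrib_left sum_distrib_right distrib_left mult_ac)
  finally show ?thesis .
qed

text \<open>
  At 0 the propagation functions are the same for all tables. A stage with \<open>\<Delta>c\<^sub>i = 0\<close> relies on
  this, because there need not be a stable member of the family that its matrix entries could
  refer to.
\<close>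

lemma prop_RK_0 [simp]: "prop_RK T 0 = 1"
  by (simp add: prop_RK_def Let_def)

lemma prop_F_0 [simp]: "prop_F T 0 = 1"
  by (simp add: prop_F_def Let_def)

lemma explicit_rk_sts_table:
  assumes "\<forall>m\<in>M. explicit_rk m (sts m)" and "\<exists>m\<in>M. stab m x"
  shows "\<exists>m. explicit_rk m (sts_table M stab sts x)"
proof -
  have "(LEAST m. m \<in> M \<and> stab m x) \<in> M"
    using assms(2) LeastI_ex[of "\<lambda>m. m \<in> M \<and> stab m x"] by blast
  thus ?thesis
    using assms(1) by (auto simp: sts_table_def)
qed


section \<open>The rows of the matrix and the stages of the method\<close>

lemma ext_sts_matrix_carrier:
  assumes "c \<in> carrier_vec s" "0 < s" "AI \<in> carrier_mat s s" "AE \<in> carrier_mat s s"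
  shows "ext_sts_matrix tab AI AE c etaD etaA etaR \<in> carrier_mat s s"
  using assms
  by (auto simp: ext_sts_matrix_def sts_P_def sts_Q_def diag_vec_def Let_def)

lemma ext_sts_matrix_mult_nth:
  fixes AI AE :: "real mat" and etaA etaR :: complex
  assumes c: "c \<in> carrier_vec s" and s: "0 < s"
    and AI: "AI \<in> carrier_mat s s" and AE: "AE \<in> carrier_mat s s"
    and z: "z \<in> carrier_vec s" and i: "i < s"
  shows "(ext_sts_matrix tab AI AE c etaD etaA etaR *\<^sub>v z) $ i =
    (if i = 0 then z $ 0
     else z $ i - of_real (prop_RK (tab (dc c i * etaD)) (dc c i * etaD)) * z $ (i - 1) -
       of_real (prop_F (tab (dc c i * etaD)) (dc c i * etaD)) *
       (\<Sum>j<s. (etaR * of_real (AI $$ (i, j) - AI $$ (i - 1, j)) +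
         etaA * of_real (AE $$ (i, j) - AE $$ (i - 1, j))) * z $ j))"
proof -
  define L where "L = etaR \<cdot>\<^sub>m map_mat complex_of_real AI + etaA \<cdot>\<^sub>m map_mat complex_of_real AE"
  define wP where "wP = vec (s - 1) (\<lambda>k. complex_of_real
    (prop_RK (tab (dc c (k + 1) * etaD)) (dc c (k + 1) * etaD)))"
  define wF where "wF = vec (s - 1) (\<lambda>k. complex_of_real
    (prop_F (tab (dc c (k + 1) * etaD)) (dc c (k + 1) * etaD)))"
  have dims: "dim_vec c = s" "dim_vec wP + 1 = s" "dim_vec wF + 1 = s"
    using c s by (auto simp: wP_def wF_def)
  have L: "L \<in> carrier_mat s s"
    using AI AE by (simp add: L_def)
  have Lz: "L *\<^sub>v z \<in> carrier_vec s"
    using L z by (rule mult_mat_vec_carrier)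
  have P: "diag_vec wP (-1) \<in> carrier_mat s s"
    and Q0: "diag_vec (vCons 0 wF) 0 \<in> carrier_mat s s"
    and Q1: "diag_vec wF (-1) \<in> carrier_mat s s"
    using dims diag_vec_carrier[of wP "-1"] diag_vec_carrier[of "vCons 0 wF" 0]
      diag_vec_carrier[of wF "-1"] by auto
  note Q = minus_carrier_mat[OF Q1, of "diag_vec (vCons 0 wF) 0"]
  have "ext_sts_matrix tab AI AE c etaD etaA etaR =
      1\<^sub>m s - diag_vec wP (-1) - (diag_vec (vCons 0 wF) 0 - diag_vec wF (-1)) * L"
    by (simp add: ext_sts_matrix_def sts_P_def sts_Q_def L_def wP_def wF_def dims Let_def)
  hence mult: "ext_sts_matrix tab AI AE c etaD etaA etaR *\<^sub>v z =
      z - diag_vec wP (-1) *\<^sub>v z -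
      (diag_vec (vCons 0 wF) 0 *\<^sub>v (L *\<^sub>v z) - diag_vec wF (-1) *\<^sub>v (L *\<^sub>v z))"
    using z
    by (simp add: minus_mult_distrib_mat_vec[OF minus_carrier_mat[OF P] mult_carrier_mat[OF Q L] z]
        minus_mult_distrib_mat_vec[OF one_carrier_mat P z] assoc_mult_mat_vec[OF Q L z]
        minus_mult_distrib_mat_vec[OF Q0 Q1 Lz])
  have Lz_nth: "(L *\<^sub>v z) $ k =
      (\<Sum>j<s. (etaR * of_real (AI $$ (k, j)) + etaA * of_real (AE $$ (k, j))) * z $ j)"
    if "k < s" for k
    using mult_mat_vec_nth_sum[OF L z that] AI AE that by (simp add: L_def)
  have "(diag_vec wP (-1) *\<^sub>v z) $ i = (if i = 0 then 0 else wP $ (i - 1) * z $ (i - 1))"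
    using dims z i by (intro diag_vec_subdiag_mult_nth) auto
  moreover have "(diag_vec wF (-1) *\<^sub>v (L *\<^sub>v z)) $ i =
      (if i = 0 then 0 else wF $ (i - 1) * (L *\<^sub>v z) $ (i - 1))"
    using dims Lz i by (intro diag_vec_subdiag_mult_nth) auto
  moreover have "(diag_vec (vCons 0 wF) 0 *\<^sub>v (L *\<^sub>v z)) $ i = vCons 0 wF $ i * (L *\<^sub>v z) $ i"
    using dims Lz i by (intro diag_vec_0_mult_nth) auto
  ultimately have row: "(ext_sts_matrix tab AI AE c etaD etaA etaR *\<^sub>v z) $ i =
      z $ i - (if i = 0 then 0 else wP $ (i - 1) * z $ (i - 1)) -
      (vCons 0 wF $ i * (L *\<^sub>v z) $ i - (if i = 0 then 0 else wF $ (i - 1) * (L *\<^sub>v z) $ (i - 1)))"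
    unfolding mult using P Q0 Q1 i by simp
  show ?thesis
  proof (cases i)
    case 0
    thus ?thesis using row by simp
  next
    case (Suc k)
    have "(\<Sum>j<s. (etaR * of_real (AI $$ (i, j) - AI $$ (i - 1, j)) +
         etaA * of_real (AE $$ (i, j) - AE $$ (i - 1, j))) * z $ j) =
       (L *\<^sub>v z) $ i - (L *\<^sub>v z) $ (i - 1)"
      using i by (simp add: Lz_nth sum_subtractf[symmetric] algebra_simps)
    thus ?thesis
      using row Suc i by (simp add: wP_def wF_def right_diff_distrib)
  qed
qed

text \<open>
  Row \<open>i - 1\<close> of \<open>A\<^sup>I\<close> and rows \<open>i - 1\<close> and \<open>i\<close> of \<open>A\<^sup>E\<close> vanish from column \<open>i\<close> on, and row \<open>i\<close>
  of \<open>A\<^sup>I\<close> vanishes beyond it. Of the row difference only the diagonal entry of \<open>A\<^sup>I\<close> is therefore left outside of \<open>g\<^sub>i\<close>: this is the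
  implicit term.
\<close>

lemma ext_sts_row_difference_sum:
  fixes z :: "complex vec"
  assumes tabs: "ext_sts_tables s AI bI AE bE c" and i: "i \<in> {1..<s}"
  shows "(\<Sum>j<s. (etaR * of_real (AI $$ (i, j) - AI $$ (i - 1, j)) +
       etaA * of_real (AE $$ (i, j) - AE $$ (i - 1, j))) * z $ j) =
    (\<Sum>j<i. (etaR * of_real (AI $$ (i, j) - AI $$ (i - 1, j)) +
       etaA * of_real (AE $$ (i, j) - AE $$ (i - 1, j))) * z $ j) +
    etaR * of_real (AI $$ (i, i)) * z $ i"
proof -
  define f where "f j = (etaR * of_real (AI $$ (i, j) - AI $$ (i - 1, j)) +
       etaA * of_real (AE $$ (i, j) - AE $$ (i - 1, j))) * z $ j" for j
  have I: "\<And>i j. i < s \<Longrightarrow> j < s \<Longrightarrow> i < j \<Longrightarrow> AI $$ (i, j) = 0"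
    and E: "\<And>i j. i < s \<Longrightarrow> j < s \<Longrightarrow> i \<le> j \<Longrightarrow> AE $$ (i, j) = 0"
    using tabs by (auto simp: ext_sts_tables_def)
  have "(\<Sum>j<s. f j) = (\<Sum>j<Suc i. f j)"
    using i by (intro sum.mono_neutral_right) (auto simp: f_def I E)
  moreover have "f i = etaR * of_real (AI $$ (i, i)) * z $ i"
  proof -
    have "i - 1 < s" "i < s" "i - 1 < i"
      using i by auto
    thus ?thesis
      by (simp add: f_def I E)
  qed
  ultimately show ?thesis
    by (simp add: f_def)
qed

text \<open>
  Both kinds of stages obey one equation. For a super-time-stepping stage the forcing
  \<open>g / (\<Delta>c\<^sub>i h)\<close> acts over a step of size \<open>\<Delta>c\<^sub>i h\<close>, so that \<open>g\<close> enters without a factor, and the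
  implicit term is zero. For the other stages the propagation functions are 1.
\<close>

lemma ext_sts_stage_iff:
  fixes z :: "nat \<Rightarrow> complex" and g lamR :: complex and h lamD :: real
  assumes tabs: "ext_sts_tables s AI bI AE bE c" and h: "h > 0" and i: "i \<in> {1..<s}"
    and T: "0 < dc c i \<longrightarrow> (\<exists>m. explicit_rk m T)"
  defines "x \<equiv> dc c i * (h * lamD)"
  shows "(if AI $$ (i, i) = 0 \<and> 0 < dc c i
      then z i = rk_step T (\<lambda>\<tau> v. of_real lamD * v + (1 / (dc c i * h)) *\<^sub>R g) t (dc c i * h) (z (i - 1))
      else z i - (h * AI $$ (i, i)) *\<^sub>R (lamR * z i) = z (i - 1) + g) \<longleftrightarrow>
    z i - of_real (prop_RK T x) * z (i - 1) -
      of_real (prop_F T x) * (g + of_real h * lamR * of_real (AI $$ (i, i)) * z i) = 0"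
proof (cases "AI $$ (i, i) = 0 \<and> 0 < dc c i")
  case True
  then obtain m where m: "explicit_rk m T"
    using T by blast
  have "rk_step T (\<lambda>\<tau> v. of_real lamD * v + (1 / (dc c i * h)) *\<^sub>R g) t (dc c i * h) (z (i - 1)) =
      of_real (prop_RK T x) * z (i - 1) + of_real (prop_F T x) * g"
    using rk_step_affine[OF m, of lamD "(1 / (dc c i * h)) *\<^sub>R g" t "dc c i * h" "z (i - 1)"] True h
    by (simp add: x_def scaleR_conv_of_real mult_ac)
  thus ?thesis
    using True by (simp add: algebra_simps)
next
  case False
  (* a vanishing diagonal entry leaves only an empty step here, as abscissae do not decrease;
     otherwise solve-decoupling applies *)
  have "0 \<le> dc c i" "AI $$ (i, i) * dc c i = 0"
    using tabs i by (auto simp: ext_sts_tables_def)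
  with False have "dc c i = 0"
    by (cases "AI $$ (i, i) = 0") auto
  thus ?thesis
    by (simp add: x_def scaleR_conv_of_real algebra_simps)
qed

text \<open>
  Column \<open>j\<close> is the image of the \<open>j\<close>-th unit vector, so the entries follow from the row formula:
  above the diagonal a row meets only zero components, and on the diagonal only the implicit
  term is added to 1.
\<close>

lemma det_ext_sts_matrix_nonzero:
  assumes tabs: "ext_sts_tables s AI bI AE bE c"
    and solvable: "\<forall>i\<in>{1..<s}. 1 - etaR * of_real (AI $$ (i, i)) \<noteq> 0"
  shows "det (ext_sts_matrix tab AI AE c etaD etaA etaR) \<noteq> 0"
proof -
  have car: "c \<in> carrier_vec s" "0 < s" "AI \<in> carrier_mat s s" "AE \<in> carrier_mat s s"
    using tabs by (auto simp: ext_sts_tables_def)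
  define K where "K = ext_sts_matrix tab AI AE c etaD etaA etaR"
  have K: "K \<in> carrier_mat s s"
    unfolding K_def using car by (rule ext_sts_matrix_carrier)
  have entry: "K $$ (i, j) = (K *\<^sub>v unit_vec s j) $ i" if "i < s" "j < s" for i j
    using K that by simp
  show ?thesis
    unfolding K_def[symmetric]
  proof (rule det_lower_triangular_nonzero[OF K])
    fix i j assume ij: "i < j" "j < s"
    thus "K $$ (i, j) = 0"
      using ext_sts_matrix_mult_nth[OF car unit_vec_carrier[of s j], of i tab etaD etaA etaR]
        ext_sts_row_difference_sum[OF tabs, of i etaR etaA "unit_vec s j"]
      by (simp add: entry K_def[symmetric] del: index_mult_mat_vec)
  next
    fix i assume i: "i < s"
    show "K $$ (i, i) \<noteq> 0"
    proof (cases "i = 0")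
      case True
      thus ?thesis
        using ext_sts_matrix_mult_nth[OF car unit_vec_carrier[of s i], of i tab etaD etaA etaR] i
        by (simp add: entry K_def[symmetric] del: index_mult_mat_vec)
    next
      case False
      define F where "F = complex_of_real (prop_F (tab (dc c i * etaD)) (dc c i * etaD))"
      have "K $$ (i, i) = 1 - F * (etaR * of_real (AI $$ (i, i)))"
        using ext_sts_matrix_mult_nth[OF car unit_vec_carrier[of s i], of i tab etaD etaA etaR] i False
          ext_sts_row_difference_sum[OF tabs, of i etaR etaA "unit_vec s i"]
        by (simp add: entry K_def[symmetric] F_def del: index_mult_mat_vec)
      moreover have "AI $$ (i, i) = 0 \<or> F = 1"
        using tabs i False by (auto simp: ext_sts_tables_def F_def)
      ultimately show ?thesis
        using solvable i False by auto
    qed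
  qed
qed


section \<open>The stability function\<close>

theorem lemma3p4:
  fixes s :: nat and AI AE :: "real mat" and bI bE c :: "real vec"
    and M :: "nat set" and stab :: "nat \<Rightarrow> real \<Rightarrow> bool" and sts :: "nat \<Rightarrow> rk_table"
    and h lamD etaD :: real and lamA lamR etaA etaR :: complex
  assumes "ext_sts_tables s AI bI AE bE c"
    and "h > 0" and "lamD < 0" and "Re lamA < 0" and "Re lamR < 0"
    and "etaD = h * lamD" and "etaA = of_real h * lamA" and "etaR = of_real h * lamR"
    and "\<forall>m\<in>M. explicit_rk m (sts m)"
    and "\<forall>i\<in>{1..<s}. 0 < dc c i \<longrightarrow> (\<exists>m\<in>M. stab m (dc c i * etaD))"
    and "\<forall>i\<in>{1..<s}. 1 - etaR * of_real (AI $$ (i, i)) \<noteq> 0"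
  shows "invertible_mat (ext_sts_matrix (sts_table M stab sts) AI AE c etaD etaA etaR) \<and>
    (\<forall>tn yn ynext.
      ext_sts_step AI AE c (\<lambda>i. sts_table M stab sts (dc c i * etaD))
        (\<lambda>t y. lamA * y) (\<lambda>t y. of_real lamD * y) (\<lambda>t y. lamR * y) h tn yn ynext \<longleftrightarrow>
      ynext = ext_sts_stability (sts_table M stab sts) AI AE c etaD etaA etaR * yn)"
proof -
  let ?tab = "sts_table M stab sts"
  let ?T = "\<lambda>i. ?tab (dc c i * etaD)"
  define K where "K = ext_sts_matrix ?tab AI AE c etaD etaA etaR"
  note tabs = assms(1)
  have car: "c \<in> carrier_vec s" "0 < s" "AI \<in> carrier_mat s s" "AE \<in> carrier_mat s s"
    using tabs by (auto simp: ext_sts_tables_def)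
  have dimc: "dim_vec c = s"
    using car by auto
  have K: "K \<in> carrier_mat s s"
    unfolding K_def using car by (rule ext_sts_matrix_carrier)
  have det: "det K \<noteq> 0"
    unfolding K_def using tabs assms(11) by (rule det_ext_sts_matrix_nonzero)
  note inv = mat_inv_of_det_nonzero[of K s, OF K det]
  have "invertible_mat K"
    using K inv unfolding invertible_mat_def inverts_mat_def
    by (metis carrier_matD square_mat.simps)
  moreover have "ext_sts_step AI AE c ?T (\<lambda>t y. lamA * y) (\<lambda>t y. of_real lamD * y)
      (\<lambda>t y. lamR * y) h tn yn ynext \<longleftrightarrow>
      ynext = ext_sts_stability ?tab AI AE c etaD etaA etaR * yn" for tn yn ynext
  proof -
    define stages where "stages z \<longleftrightarrow> z 0 = yn \<and>
        (\<forall>i\<in>{1..<s}.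
          let g = ext_sts_g AI AE c (\<lambda>t y. lamA * y) (\<lambda>t y. lamR * y) h tn z i in
          if AI $$ (i, i) = 0 \<and> 0 < dc c i
          then z i = rk_step (?T i) (\<lambda>\<tau> v. of_real lamD * v + (1 / (dc c i * h)) *\<^sub>R g)
            (tn + c $ (i - 1) * h) (dc c i * h) (z (i - 1))
          else z i - (h * AI $$ (i, i)) *\<^sub>R (lamR * z i) = z (i - 1) + g)" for z
    define y0 where "y0 = yn \<cdot>\<^sub>v unit_vec s 0"
    have y0: "y0 \<in> carrier_vec s"
      by (simp add: y0_def)
    have stages_iff: "stages z \<longleftrightarrow> K *\<^sub>v vec s z = y0" for z
    proof -
      have row0: "z 0 = yn \<longleftrightarrow> (K *\<^sub>v vec s z) $ 0 = y0 $ 0"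
        using ext_sts_matrix_mult_nth[OF car, of "vec s z" 0 ?tab etaD etaA etaR] car(2)
        by (simp add: K_def[symmetric] y0_def del: index_mult_mat_vec)
      have row: "(let g = ext_sts_g AI AE c (\<lambda>t y. lamA * y) (\<lambda>t y. lamR * y) h tn z i in
          if AI $$ (i, i) = 0 \<and> 0 < dc c i
          then z i = rk_step (?T i) (\<lambda>\<tau> v. of_real lamD * v + (1 / (dc c i * h)) *\<^sub>R g)
            (tn + c $ (i - 1) * h) (dc c i * h) (z (i - 1))
          else z i - (h * AI $$ (i, i)) *\<^sub>R (lamR * z i) = z (i - 1) + g) \<longleftrightarrow>
        (K *\<^sub>v vec s z) $ i = y0 $ i" if i: "i \<in> {1..<s}" for i
      proof -
        have T: "0 < dc c i \<longrightarrow> (\<exists>m. explicit_rk m (?T i))"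
          using explicit_rk_sts_table[OF assms(9)] assms(10) i by blast
        have g: "ext_sts_g AI AE c (\<lambda>t y. lamA * y) (\<lambda>t y. lamR * y) h tn z i =
          (\<Sum>j<i. (etaR * of_real (AI $$ (i, j) - AI $$ (i - 1, j)) +
            etaA * of_real (AE $$ (i, j) - AE $$ (i - 1, j))) * vec s z $ j)"
          unfolding ext_sts_g_def scaleR_sum_right using i assms(7,8)
          by (intro sum.cong) (auto simp: scaleR_conv_of_real algebra_simps)
        have "i < s" "i - 1 < s" "i \<noteq> 0"
          using i by auto
        thus ?thesis
          unfolding Let_def ext_sts_stage_iff[OF tabs assms(2) i T, where z = z] g
          unfolding assms(6,8)[symmetric]
          using ext_sts_matrix_mult_nth[OF car, of "vec s z" i ?tab etaD etaA etaR, folded K_def]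
            ext_sts_row_difference_sum[OF tabs i, of etaR etaA "vec s z"]
          by (simp add: y0_def del: index_mult_mat_vec)
      qed
      have "K *\<^sub>v vec s z = y0 \<longleftrightarrow> (\<forall>i<s. (K *\<^sub>v vec s z) $ i = y0 $ i)"
        using K y0 by (auto simp: vec_eq_iff)
      also have "\<dots> \<longleftrightarrow> (K *\<^sub>v vec s z) $ 0 = y0 $ 0 \<and>
          (\<forall>i\<in>{1..<s}. (K *\<^sub>v vec s z) $ i = y0 $ i)"
        using car(2) by (metis One_nat_def Suc_leI atLeastLessThan_iff neq0_conv)
      finally show ?thesis
        unfolding stages_def using row0 row by simp
    qed
    have sol: "mat_inv K *\<^sub>v y0 \<in> carrier_vec s"
      using inv(1) y0 by (rule mult_mat_vec_carrier)
    have e0: "mat_inv K *\<^sub>v unit_vec s 0 \<in> carrier_vec s"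
      using inv(1) by (rule mult_mat_vec_carrier) simp
    have "mat_inv K *\<^sub>v y0 = yn \<cdot>\<^sub>v (mat_inv K *\<^sub>v unit_vec s 0)"
      unfolding y0_def using inv(1) by (rule mult_mat_vec) simp
    hence last: "(mat_inv K *\<^sub>v y0) $ (s - 1) = ext_sts_stability ?tab AI AE c etaD etaA etaR * yn"
      using e0 car(2) inv(1) by (simp add: ext_sts_stability_def K_def[symmetric] dimc
          del: index_mult_mat_vec)
    have "ext_sts_step AI AE c ?T (\<lambda>t y. lamA * y) (\<lambda>t y. of_real lamD * y)
        (\<lambda>t y. lamR * y) h tn yn ynext \<longleftrightarrow> (\<exists>z. stages z \<and> ynext = z (s - 1))"
      unfolding ext_sts_step_def stages_def dimc by blast
    also have "\<dots> \<longleftrightarrow> (\<exists>z. vec s z = mat_inv K *\<^sub>v y0 \<and> ynext = z (s - 1))"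
      unfolding stages_iff using mult_mat_vec_eq_iff_mat_inv[OF K det vec_carrier y0] by simp
    also have "\<dots> \<longleftrightarrow> ynext = (mat_inv K *\<^sub>v y0) $ (s - 1)"
    proof
      assume "\<exists>z. vec s z = mat_inv K *\<^sub>v y0 \<and> ynext = z (s - 1)"
      then obtain z where "vec s z = mat_inv K *\<^sub>v y0" "ynext = z (s - 1)"
        by blast
      thus "ynext = (mat_inv K *\<^sub>v y0) $ (s - 1)"
        using car(2) index_vec[of "s - 1" s z] by simp
    next
      assume "ynext = (mat_inv K *\<^sub>v y0) $ (s - 1)"
      moreover have "vec s (\<lambda>i. (mat_inv K *\<^sub>v y0) $ i) = mat_inv K *\<^sub>v y0"
        using sol inv(1) by (intro eq_vecI) auto
      ultimately show "\<exists>z. vec s z = mat_inv K *\<^sub>v y0 \<and> ynext = z (s - 1)"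
        by blast
    qed
    finally show ?thesis
      unfolding last .
  qed
  ultimately show ?thesis
    unfolding K_def by blast
qed

end
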